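(* Let $X$ be a uniformly smooth Banach space and let $H$ be a Hilbert space. Then the pair $(X\times H,\mathbb{K})$ has the Bishop-Phelps-Bollobás point property for bilinear forms if and only if the pair $(X,H^* )$ has the Bishop-Phelps-Bollobás point property (for operators).
   Context: All spaces are over the same scalar field $\mathbb{K}$, which is $\mathbb{R}$ or $\mathbb{C}$. $S_X$ and $B_X$ are the unit sphere and closed unit ball of $X$, $H^*$ is the topological dual of $H$, and $\mathcal{L}(X,Y)$ is the space of bounded linear operators from $X$ into $Y$. A Banach space $X$ is uniformly smooth if the limit $\lim_{t\to 0}\frac{\|z+tx\|-1}{t}$ exists uniformly for all $x\in B_X$ and $z\in S_X$. A pair $(X,Y)$ of Banach spaces has the Bishop-Phelps-Bollobás point property (BPBpp, for operators) if for every $\varepsilon>0$ there exists $\eta(\varepsilon)>0$ such that whenever $T\in\mathcal{L}(X,Y)$ with $\|T\|=1$ and $x\in S_X$ satisfy $\|T(x)\|>1-\eta(\varepsilon)$, there exists $S\in\mathcal{L}(X,Y)$ with $\|S\|=1$ such that $\|S(x)\|=1$ and $\|S-T\|<\varepsilon$. For Banach spaces $X,Y,Z$, $B(X\times Y,Z)$ is the Banach space of bounded bilinear mappings from $X\times Y$ into $Z$ with norm $\|B\|=\sup\{\|B(x,y)\|:x\in B_X,\,y\in B_Y\}$. The pair $(X\times Y,Z)$ has the BPBpp for bilinear mappings if for every $\varepsilon>0$ there exists $\eta(\varepsilon)>0$ such that whenever $B\in B(X\times Y,Z)$ with $\|B\|=1$ and $(x_0,y_0)\in S_X\times S_Y$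 satisfy $\|B(x_0,y_0)\|>1-\eta(\varepsilon)$, there exists $A\in B(X\times Y,Z)$ with $\|A\|=1$ such that $\|A(x_0,y_0)\|=1$ and $\|A-B\|<\varepsilon$. When $Z=\mathbb{K}$ one says that $(X\times Y,\mathbb{K})$ has the BPBpp for bilinear forms. *)

theory Defs
  imports "HOL-Analysis.Analysis"
begin

text \<open>
  HOL-Analysis provides real normed spaces only. The classes below add a complex scalar
  multiplication that extends the real one; the norm is the one of the underlying real normed space.
\<close>

class scaleC =
  fixes scaleC :: "complex \<Rightarrow> 'a \<Rightarrow> 'a" (infixr "*\<^sub>C" 75)

class complex_vector = real_vector + scaleC +
  assumes scaleC_add_right: "a *\<^sub>C (x + y) = a *\<^sub>C x + a *\<^sub>C y"
    and scaleC_add_left: "(a + b) *\<^sub>C x = a *\<^sub>C x + b *\<^sub>C x"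
    and scaleC_scaleC: "a *\<^sub>C (b *\<^sub>C x) = (a * b) *\<^sub>C x"
    and scaleC_of_real: "complex_of_real r *\<^sub>C x = r *\<^sub>R x"

class complex_normed_vector = complex_vector + real_normed_vector +
  assumes norm_scaleC: "norm (a *\<^sub>C x) = cmod a * norm x"

class cbanach = complex_normed_vector + complete_space

subclass (in cbanach) banach ..

class complex_inner = complex_normed_vector +
  fixes cinner :: "'a \<Rightarrow> 'a \<Rightarrow> complex"
  assumes cinner_commute: "cinner x y = cnj (cinner y x)"
    and cinner_add_left: "cinner (x + y) z = cinner x z + cinner y z"
    and cinner_scaleC_left: "cinner (a *\<^sub>C x) y = a * cinner x y"
    and cinner_self: "cinner x x = complex_of_real ((norm x)\<^sup>2)"

class chilbert_space = complex_inner + complete_space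

subclass (in chilbert_space) cbanach ..

instantiation complex :: chilbert_space
begin

definition scaleC_complex_def: "a *\<^sub>C (z::complex) = a * z"

definition cinner_complex_def: "cinner (w::complex) z = w * cnj z"

instance
  by standard
    (auto simp: scaleC_complex_def cinner_complex_def algebra_simps norm_mult scaleR_conv_of_real
        complex_norm_square simp del: of_real_power)

end

text \<open>
  The complex counterpart of the library type of bounded real-linear operators: its closed subspace
  of complex-linear elements, with the same operator norm. In particular
  \<open>'h \<Rightarrow>\<^sub>C\<^sub>L complex\<close> is the topological dual of a complex normed space.
\<close>

typedef (overloaded) ('a, 'b) cblinfun ("(_ \<Rightarrow>\<^sub>C\<^sub>L /_)" [22, 21] 21) =
  "{f :: 'a::complex_normed_vector \<Rightarrow>\<^sub>L 'b::complex_normed_vector.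
     \<forall>c x. blinfun_apply f (c *\<^sub>C x) = c *\<^sub>C blinfun_apply f x}"
  morphisms blinfun_of_cblinfun Abs_cblinfun
proof
  have "(0::'b) = c *\<^sub>C 0" for c
    using norm_scaleC[of c "0::'b"] by simp
  then show "0 \<in> {f :: 'a \<Rightarrow>\<^sub>L 'b. \<forall>c x. blinfun_apply f (c *\<^sub>C x) = c *\<^sub>C blinfun_apply f x}"
    by simp
qed

setup_lifting type_definition_cblinfun

definition cblinfun_apply ::
  "('a::complex_normed_vector \<Rightarrow>\<^sub>C\<^sub>L 'b::complex_normed_vector) \<Rightarrow> 'a \<Rightarrow> 'b" where
  "cblinfun_apply f = blinfun_apply (blinfun_of_cblinfun f)"

lemma scaleC_zero_right: "c *\<^sub>C (0::'a::complex_normed_vector) = 0"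
  using norm_scaleC[of c "0::'a"] by simp

lemma scaleC_minus_right: "c *\<^sub>C (- x) = - (c *\<^sub>C (x::'a::complex_normed_vector))"
  using scaleC_add_right[of c x "- x"] by (simp add: scaleC_zero_right eq_neg_iff_add_eq_0 add.commute)

lemma scaleC_diff_right: "c *\<^sub>C (x - y) = c *\<^sub>C x - c *\<^sub>C (y::'a::complex_normed_vector)"
  using scaleC_add_right[of c x "- y"] by (simp add: scaleC_minus_right)

lemma scaleC_scaleR_commute:
  "c *\<^sub>C (r *\<^sub>R x) = r *\<^sub>R (c *\<^sub>C (x::'a::complex_normed_vector))"
  by (simp only: scaleC_of_real[symmetric] scaleC_scaleC mult.commute)

lemma bounded_linear_scaleC: "bounded_linear (\<lambda>x::'a::complex_normed_vector. c *\<^sub>C x)"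
  by (rule bounded_linear_intro[where K = "cmod c"])
    (simp_all add: scaleC_add_right scaleC_scaleR_commute norm_scaleC mult.commute)

instantiation cblinfun :: (complex_normed_vector, complex_normed_vector) real_normed_vector
begin

lift_definition zero_cblinfun :: "'a \<Rightarrow>\<^sub>C\<^sub>L 'b" is 0
  by (simp add: scaleC_zero_right)

lift_definition plus_cblinfun :: "'a \<Rightarrow>\<^sub>C\<^sub>L 'b \<Rightarrow> 'a \<Rightarrow>\<^sub>C\<^sub>L 'b \<Rightarrow> 'a \<Rightarrow>\<^sub>C\<^sub>L 'b" is "(+)"
  by (simp add: plus_blinfun.rep_eq scaleC_add_right)

lift_definition uminus_cblinfun :: "'a \<Rightarrow>\<^sub>C\<^sub>L 'b \<Rightarrow> 'a \<Rightarrow>\<^sub>C\<^sub>L 'b" is uminus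
  by (simp add: uminus_blinfun.rep_eq scaleC_minus_right)

lift_definition minus_cblinfun :: "'a \<Rightarrow>\<^sub>C\<^sub>L 'b \<Rightarrow> 'a \<Rightarrow>\<^sub>C\<^sub>L 'b \<Rightarrow> 'a \<Rightarrow>\<^sub>C\<^sub>L 'b" is "(-)"
  by (simp add: minus_blinfun.rep_eq scaleC_diff_right)

lift_definition scaleR_cblinfun :: "real \<Rightarrow> 'a \<Rightarrow>\<^sub>C\<^sub>L 'b \<Rightarrow> 'a \<Rightarrow>\<^sub>C\<^sub>L 'b" is scaleR
  by (simp add: scaleR_blinfun.rep_eq scaleC_scaleR_commute)

lift_definition norm_cblinfun :: "'a \<Rightarrow>\<^sub>C\<^sub>L 'b \<Rightarrow> real" is norm .

definition dist_cblinfun :: "'a \<Rightarrow>\<^sub>C\<^sub>L 'b \<Rightarrow> 'a \<Rightarrow>\<^sub>C\<^sub>L 'b \<Rightarrow> real"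
  where "dist_cblinfun f g = norm (f - g)"

definition sgn_cblinfun :: "'a \<Rightarrow>\<^sub>C\<^sub>L 'b \<Rightarrow> 'a \<Rightarrow>\<^sub>C\<^sub>L 'b"
  where "sgn_cblinfun f = scaleR (inverse (norm f)) f"

definition uniformity_cblinfun :: "(('a \<Rightarrow>\<^sub>C\<^sub>L 'b) \<times> ('a \<Rightarrow>\<^sub>C\<^sub>L 'b)) filter"
  where "uniformity_cblinfun = (INF e\<in>{0 <..}. principal {(f, g). dist f g < e})"

definition open_cblinfun :: "('a \<Rightarrow>\<^sub>C\<^sub>L 'b) set \<Rightarrow> bool"
  where "open_cblinfun U \<longleftrightarrow> (\<forall>f\<in>U. \<forall>\<^sub>F (f', g) in uniformity. f' = f \<longrightarrow> g \<in> U)"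

instance
  by standard
    (unfold dist_cblinfun_def sgn_cblinfun_def uniformity_cblinfun_def open_cblinfun_def,
      (rule refl | (transfer, force simp: norm_triangle_ineq algebra_simps))+)

end

instantiation cblinfun :: (complex_normed_vector, complex_normed_vector) complex_normed_vector
begin

lift_definition scaleC_cblinfun :: "complex \<Rightarrow> 'a \<Rightarrow>\<^sub>C\<^sub>L 'b \<Rightarrow> 'a \<Rightarrow>\<^sub>C\<^sub>L 'b"
  is "\<lambda>c f. blinfun_compose (Blinfun (\<lambda>y. c *\<^sub>C y)) f"
  by (simp add: bounded_linear_Blinfun_apply bounded_linear_scaleC scaleC_scaleC mult.commute)

instance
proof
  have scaleC_apply: "blinfun_apply (blinfun_of_cblinfun (c *\<^sub>C f)) x
      = c *\<^sub>C blinfun_apply (blinfun_of_cblinfun f) x" for c and f :: "'a \<Rightarrow>\<^sub>C\<^sub>L 'b" and x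
    by (simp add: scaleC_cblinfun.rep_eq bounded_linear_Blinfun_apply bounded_linear_scaleC)
  have eqI: "f = g" if "\<And>x. blinfun_apply (blinfun_of_cblinfun f) x = blinfun_apply (blinfun_of_cblinfun g) x"
    for f g :: "'a \<Rightarrow>\<^sub>C\<^sub>L 'b"
    using that by (metis blinfun_eqI blinfun_of_cblinfun_inject)
  note rep = plus_cblinfun.rep_eq scaleR_cblinfun.rep_eq plus_blinfun.rep_eq scaleR_blinfun.rep_eq
  fix f g :: "'a \<Rightarrow>\<^sub>C\<^sub>L 'b" and a b :: complex and r :: real
  show "a *\<^sub>C (f + g) = a *\<^sub>C f + a *\<^sub>C g" 
    by (rule eqI) (simp add: scaleC_apply rep scaleC_add_right)
  show "(a + b) *\<^sub>C f = a *\<^sub>C f + b *\<^sub>C f"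
    by (rule eqI) (simp add: scaleC_apply rep scaleC_add_left)
  show "a *\<^sub>C b *\<^sub>C f = (a * b) *\<^sub>C f"
    by (rule eqI) (simp add: scaleC_apply scaleC_scaleC)
  show "complex_of_real r *\<^sub>C f = r *\<^sub>R f"
    by (rule eqI) (simp add: scaleC_apply rep scaleC_of_real)
  have le: "norm (c *\<^sub>C k) \<le> cmod c * norm k" for c and k :: "'a \<Rightarrow>\<^sub>C\<^sub>L 'b"
    unfolding norm_cblinfun.rep_eq
    by (rule norm_blinfun_bound)
      (auto simp: scaleC_apply norm_scaleC mult.assoc intro!: mult_left_mono norm_blinfun)
  show "norm (a *\<^sub>C f) = cmod a * norm f"
  proof (cases "a = 0")
    case True
    then show ?thesis using le[of 0 f] by simp
  next
    case False
    have "1 *\<^sub>C y = y" for y :: 'b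
      using scaleC_of_real[of 1 y] by simp
    then have "inverse a *\<^sub>C a *\<^sub>C f = f"
      using False by (intro eqI) (simp add: scaleC_apply scaleC_scaleC)
    then have "cmod a * norm f \<le> cmod a * (cmod (inverse a) * norm (a *\<^sub>C f))"
      using le[of "inverse a" "a *\<^sub>C f"] by (simp add: mult_left_mono)
    also have "\<dots> = norm (a *\<^sub>C f)"
      using False by (simp add: norm_inverse)
    finally show ?thesis using le[of a f] by simp
  qed
qed

end

instance cblinfun :: (complex_normed_vector, cbanach) cbanach
proof
  fix X :: "nat \<Rightarrow> 'a \<Rightarrow>\<^sub>C\<^sub>L 'b"
  have dist: "dist f g = dist (blinfun_of_cblinfun f) (blinfun_of_cblinfun g)"
    for f g :: "'a \<Rightarrow>\<^sub>C\<^sub>L 'b"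
    by (simp add: dist_norm norm_cblinfun.rep_eq minus_cblinfun.rep_eq)
  assume "Cauchy X"
  then have "Cauchy (\<lambda>n. blinfun_of_cblinfun (X n))"
    by (simp add: Cauchy_def dist)
  then have "convergent (\<lambda>n. blinfun_of_cblinfun (X n))"
    by (rule Cauchy_convergent)
  then obtain L where L: "(\<lambda>n. blinfun_of_cblinfun (X n)) \<longlonglongrightarrow> L"
    by (auto simp: convergent_def)
  have "blinfun_apply L (c *\<^sub>C x) = c *\<^sub>C blinfun_apply L x" for c x
  proof (rule LIMSEQ_unique)
    show "(\<lambda>n. blinfun_apply (blinfun_of_cblinfun (X n)) (c *\<^sub>C x))
        \<longlonglongrightarrow> blinfun_apply L (c *\<^sub>C x)"
      by (intro tendsto_intros L)
    have "(\<lambda>n. c *\<^sub>C blinfun_apply (blinfun_of_cblinfun (X n)) x)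
        \<longlonglongrightarrow> c *\<^sub>C blinfun_apply L x"
      by (intro bounded_linear.tendsto[OF bounded_linear_scaleC] tendsto_intros L)
    then show "(\<lambda>n. blinfun_apply (blinfun_of_cblinfun (X n)) (c *\<^sub>C x))
        \<longlonglongrightarrow> c *\<^sub>C blinfun_apply L x"
      using blinfun_of_cblinfun[of "X _"] by simp
  qed
  then have "blinfun_of_cblinfun (Abs_cblinfun L) = L"
    by (simp add: Abs_cblinfun_inverse)
  then have "X \<longlonglongrightarrow> Abs_cblinfun L"
    using L by (simp add: lim_sequentially dist)
  then show "convergent X"
    by (auto simp: convergent_def)
qed

text \<open>The limit is over real \<open>t\<close>, for real and for complex spaces.\<close>

definition uniformly_smooth :: "'x::real_normed_vector itself \<Rightarrow> bool" where
  "uniformly_smooth _ \<longleftrightarrow>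
    (\<exists>l. uniform_limit (sphere (0::'x) 1 \<times> cball 0 1)
           (\<lambda>(t::real) (z, x). (norm (z + t *\<^sub>R x) - 1) / t) l (at 0))"

definition BPBpp_real :: "'x::banach itself \<Rightarrow> 'y::banach itself \<Rightarrow> bool" where
  "BPBpp_real _ _ \<longleftrightarrow>
    (\<forall>\<epsilon>>0. \<exists>\<eta>>0. \<forall>(T :: 'x \<Rightarrow>\<^sub>L 'y) x.
       norm T = 1 \<and> norm x = 1 \<and> norm (blinfun_apply T x) > 1 - \<eta> \<longrightarrow>
       (\<exists>S :: 'x \<Rightarrow>\<^sub>L 'y. norm S = 1 \<and> norm (blinfun_apply S x) = 1 \<and> norm (S - T) < \<epsilon>))"

definition BPBpp_complex :: "'x::cbanach itself \<Rightarrow> 'y::cbanach itself \<Rightarrow> bool" where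
  "BPBpp_complex _ _ \<longleftrightarrow>
    (\<forall>\<epsilon>>0. \<exists>\<eta>>0. \<forall>(T :: 'x \<Rightarrow>\<^sub>C\<^sub>L 'y) x.
       norm T = 1 \<and> norm x = 1 \<and> norm (cblinfun_apply T x) > 1 - \<eta> \<longrightarrow>
       (\<exists>S :: 'x \<Rightarrow>\<^sub>C\<^sub>L 'y. norm S = 1 \<and> norm (cblinfun_apply S x) = 1 \<and> norm (S - T) < \<epsilon>))"

definition bounded_cbilinear ::
  "('x::complex_normed_vector \<Rightarrow> 'y::complex_normed_vector \<Rightarrow> 'z::complex_normed_vector) \<Rightarrow> bool" where
  "bounded_cbilinear B \<longleftrightarrow> bounded_bilinear B \<and>
    (\<forall>c x y. B (c *\<^sub>C x) y = c *\<^sub>C B x y) \<and> (\<forall>c x y. B x (c *\<^sub>C y) = c *\<^sub>C B x y)"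

text \<open>The supremum is meaningful for bounded bilinear mappings only.\<close>

definition bilinear_norm ::
  "('x::real_normed_vector \<Rightarrow> 'y::real_normed_vector \<Rightarrow> 'z::real_normed_vector) \<Rightarrow> real" where
  "bilinear_norm B = (SUP (x, y) \<in> cball 0 1 \<times> cball 0 1. norm (B x y))"

definition BPBpp_bilinear_real ::
  "'x::banach itself \<Rightarrow> 'y::banach itself \<Rightarrow> 'z::banach itself \<Rightarrow> bool" where
  "BPBpp_bilinear_real _ _ _ \<longleftrightarrow>
    (\<forall>\<epsilon>>0. \<exists>\<eta>>0. \<forall>(B :: 'x \<Rightarrow> 'y \<Rightarrow> 'z) x0 y0.
       bounded_bilinear B \<and> bilinear_norm B = 1 \<and> norm x0 = 1 \<and> norm y0 = 1 \<and>
       norm (B x0 y0) > 1 - \<eta> \<longrightarrow>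
       (\<exists>A :: 'x \<Rightarrow> 'y \<Rightarrow> 'z. bounded_bilinear A \<and> bilinear_norm A = 1 \<and>
          norm (A x0 y0) = 1 \<and> bilinear_norm (\<lambda>x y. A x y - B x y) < \<epsilon>))"

definition BPBpp_bilinear_complex ::
  "'x::cbanach itself \<Rightarrow> 'y::cbanach itself \<Rightarrow> 'z::cbanach itself \<Rightarrow> bool" where
  "BPBpp_bilinear_complex _ _ _ \<longleftrightarrow>
    (\<forall>\<epsilon>>0. \<exists>\<eta>>0. \<forall>(B :: 'x \<Rightarrow> 'y \<Rightarrow> 'z) x0 y0.
       bounded_cbilinear B \<and> bilinear_norm B = 1 \<and> norm x0 = 1 \<and> norm y0 = 1 \<and>
       norm (B x0 y0) > 1 - \<eta> \<longrightarrow>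
       (\<exists>A :: 'x \<Rightarrow> 'y \<Rightarrow> 'z. bounded_cbilinear A \<and> bilinear_norm A = 1 \<and>
          norm (A x0 y0) = 1 \<and> bilinear_norm (\<lambda>x y. A x y - B x y) < \<epsilon>))"

end

theory Submission
  imports Defs
begin

text \<open>
  A bounded bilinear form on \<open>X \<times> H\<close> is the same thing as an operator from \<open>X\<close> into the dual
  of \<open>H\<close>, with the same norm. The two point properties differ only in what is prescribed: for
  operators a point of \<open>X\<close>, for forms a point of \<open>X\<close> and a point of \<open>H\<close>.

  If the property holds for forms and \<open>T x\<close> has norm close to \<open>1\<close>, any unit vector \<open>y\<close> at which
  the modulus of \<open>T x\<close> is close to \<open>1\<close> completes \<open>x\<close> to a pair. The form found for the pair
  \<open>(x, y)\<close> is an operator that attains its norm at \<open>x\<close>.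

  Conversely, let \<open>T x y\<close> have modulus close to \<open>1\<close> and let \<open>S\<close> be an operator close to \<open>T\<close> with
  \<open>S x\<close> of norm one. The functional \<open>S x\<close> need not attain its norm at \<open>y\<close>, but it does at
  some unit vector \<open>v\<close> (\<open>norm_attained\<close>). After a rotation of \<open>v\<close> by a scalar, \<open>S x v\<close> and
  \<open>S x y\<close> have the same phase, so \<open>v + y\<close> has norm almost \<open>2\<close>, and the parallelogram law puts
  \<open>v\<close> close to \<open>y\<close> (\<open>unit_vectors_close\<close>). In a Hilbert space there is a linear contraction
  \<open>U\<close> with \<open>U y = v\<close> whose distance from the identity is at most \<open>2 * norm (v - y)\<close>
  (\<open>contraction_moving_unit_vector\<close>). The form \<open>\<lambda>x y. S x (U y)\<close> then has norm one, attains it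
  at \<open>(x, y)\<close>, and is close to \<open>S\<close>, hence to \<open>T\<close>.

  The argument is the same for both scalar fields, and so it is carried out once, over an abstract
  normed field with a conjugation, and then interpreted for the two kinds of spaces.
\<close>

section \<open>Hilbert spaces over the real or complex scalars\<close>

text \<open>
  The conjugation is the identity for real scalars and complex conjugation for complex ones. The
  axiom \<open>mult_conj\<close> forces it to preserve the norm of scalars, so that the inner product obeys
  the same estimates in both arguments.
\<close>

locale scalar_hilbert = vector_space scale
  for scale :: "'k::real_normed_field \<Rightarrow> 'h::banach \<Rightarrow> 'h" +
  fixes conj :: "'k \<Rightarrow> 'k" and ip :: "'h \<Rightarrow> 'h \<Rightarrow> 'k"
  assumes norm_scale: "norm (scale a x) = norm a * norm x"
    and conj_add: "conj (a + b) = conj a + conj b"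
    and conj_mult: "conj (a * b) = conj a * conj b"
    and mult_conj: "a * conj a = of_real ((norm a)\<^sup>2)"
    and ip_commute: "ip x y = conj (ip y x)"
    and ip_add_left: "ip (x + y) z = ip x z + ip y z"
    and ip_scale_left: "ip (scale a x) y = a * ip x y"
    and ip_self: "ip x x = of_real ((norm x)\<^sup>2)"
begin

lemma ip_add_right: "ip x (y + z) = ip x y + ip x z"
  by (metis ip_commute ip_add_left conj_add)

lemma ip_scale_right: "ip x (scale a y) = conj a * ip x y"
  by (metis ip_commute ip_scale_left conj_mult)

lemma ip_diff_left: "ip (x - y) z = ip x z - ip y z"
  by (metis ip_add_left add_diff_cancel diff_add_cancel)

lemma ip_diff_right: "ip x (y - z) = ip x y - ip x z"
  by (metis ip_add_right add_diff_cancel diff_add_cancel)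

lemma ip_eq_zero_commute: "ip x y = 0 \<Longrightarrow> ip y x = 0"
  by (metis ip_commute conj_add add_cancel_right_right)

lemma parallelogram:
  fixes x y :: 'h
  shows "(norm (x + y))\<^sup>2 + (norm (x - y))\<^sup>2 = 2 * (norm x)\<^sup>2 + 2 * (norm y)\<^sup>2"
proof -
  have "ip (x + y) (x + y) + ip (x - y) (x - y) = 2 * ip x x + 2 * ip y y"
    by (simp add: ip_add_left ip_add_right ip_diff_left ip_diff_right)
  then have "(of_real ((norm (x + y))\<^sup>2 + (norm (x - y))\<^sup>2) :: 'k)
      = of_real (2 * (norm x)\<^sup>2 + 2 * (norm y)\<^sup>2)"
    by (simp add: ip_self)
  then show ?thesis
    by (simp only: of_real_eq_iff)
qed

lemma pythagoras:
  assumes "ip x y = 0"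
  shows "(norm (x + y))\<^sup>2 = (norm x)\<^sup>2 + (norm y)\<^sup>2"
proof -
  have "ip (x + y) (x + y) = ip x x + ip y y"
    using assms ip_eq_zero_commute[OF assms] by (simp add: ip_add_left ip_add_right)
  then have "(of_real ((norm (x + y))\<^sup>2) :: 'k) = of_real ((norm x)\<^sup>2 + (norm y)\<^sup>2)"
    by (simp add: ip_self)
  then show ?thesis
    by (simp only: of_real_eq_iff)
qed

lemma orthogonal_residual:
  assumes "norm u = 1"
  shows "ip (y - scale (ip y u) u) u = 0"
  using assms by (simp add: ip_diff_left ip_scale_left ip_self)

lemma norm_decomposition:
  assumes "norm u = 1"
  shows "(norm y)\<^sup>2 = (norm (y - scale (ip y u) u))\<^sup>2 + (norm (ip y u))\<^sup>2"
proof -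
  have "ip (y - scale (ip y u) u) (scale (ip y u) u) = 0"
    using orthogonal_residual[OF assms] by (simp add: ip_scale_right)
  from pythagoras[OF this] show ?thesis
    using assms by (simp add: norm_scale)
qed

lemma norm_residual_le:
  assumes "norm u = 1"
  shows "norm (y - scale (ip y u) u) \<le> norm y"
  using norm_decomposition[OF assms, of y] by (simp add: power2_le_imp_le)

lemma norm_conj: "norm (conj a) = norm a"
proof (cases "a = 0")
  case True
  then show ?thesis using conj_add[of 0 0] by simp
next
  case False
  have "norm (a * conj a) = (norm a)\<^sup>2"
    unfolding mult_conj norm_of_real by simp
  then show ?thesis
    using False by (simp add: norm_mult power2_eq_square)
qed

lemma norm_ip_le: "norm (ip x y) \<le> norm x * norm y"
proof (cases "y = 0")
  case True
  then show ?thesis using ip_add_right[of x 0 0] by simp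
next
  case False
  define u where "u = scale (of_real (inverse (norm y))) y"
  have u: "norm u = 1"
    using False by (simp add: u_def norm_scale norm_inverse)
  have "norm (ip x u) \<le> norm x"
    using norm_decomposition[OF u, of x] by (simp add: power2_le_imp_le)
  moreover have "norm (ip x y) = norm y * norm (ip x u)"
    using False by (simp add: u_def ip_scale_right norm_mult norm_conj norm_inverse)
  ultimately show ?thesis
    by (simp add: mult.commute[of "norm x"] mult_left_mono)
qed

text \<open>
  The usual product of two reflections takes \<open>u\<close> to \<open>v\<close> only if \<open>ip u v\<close> is real. Instead,
  \<open>u\<close> is sent to \<open>v\<close> and the orthogonal complement of \<open>u\<close> is projected onto that of \<open>v\<close>.
  By Pythagoras this is a contraction. A vector \<open>w\<close> orthogonal to \<open>u\<close> is moved by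
  \<open>ip w v = ip w (v - u)\<close> times \<open>v\<close>, which is small if \<open>v\<close> is close to \<open>u\<close>.
\<close>

lemma contraction_moving_unit_vector:
  assumes u: "norm u = 1" and v: "norm v = 1"
  obtains U where "Vector_Spaces.linear scale scale U" "U u = v"
    "\<And>y. norm (U y) \<le> norm y" "\<And>y. norm (U y - y) \<le> 2 * norm (v - u) * norm y"
proof
  define w where "w y = y - scale (ip y u) u" for y
  define U where "U y = (w y - scale (ip (w y) v) v) + scale (ip y u) v" for y
  have w_add: "w (x + y) = w x + w y" for x y
    by (simp add: w_def ip_add_left scale_left_distrib)
  have w_scale: "w (scale a y) = scale a (w y)" for a y
    by (simp add: w_def ip_scale_left scale_right_diff_distrib)
  show "Vector_Spaces.linear scale scale U"
    by unfold_locales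
      (simp_all add: U_def w_add w_scale ip_add_left ip_scale_left scale_left_distrib
        scale_right_distrib scale_right_diff_distrib)
  have "w u = 0" "ip u u = 1"
    using u by (simp_all add: w_def ip_self)
  then show "U u = v"
    using ip_scale_left[of 0 0 v] by (simp add: U_def)
  fix y
  have "(norm (U y))\<^sup>2 = (norm (w y - scale (ip (w y) v) v))\<^sup>2 + (norm (ip y u))\<^sup>2"
  proof -
    have "ip (w y - scale (ip (w y) v) v) (scale (ip y u) v) = 0"
      using orthogonal_residual[OF v] by (simp add: ip_scale_right)
    from pythagoras[OF this] show ?thesis
      using v by (simp add: U_def norm_scale)
  qed
  also have "\<dots> \<le> (norm (w y))\<^sup>2 + (norm (ip y u))\<^sup>2"
    using norm_residual_le[OF v] by (simp add: power_mono)
  also have "\<dots> = (norm y)\<^sup>2"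
    using norm_decomposition[OF u, of y] by (simp add: w_def)
  finally show "norm (U y) \<le> norm y"
    by (rule power2_le_imp_le) simp
  have "ip (w y) v = ip (w y) (v - u)"
    using orthogonal_residual[OF u] by (simp add: w_def ip_diff_right)
  then have "norm (ip (w y) v) \<le> norm (w y) * norm (v - u)"
    using norm_ip_le by simp
  also have "\<dots> \<le> norm y * norm (v - u)"
    using norm_residual_le[OF u] by (simp add: w_def mult_right_mono)
  finally have perp: "norm (scale (ip (w y) v) v) \<le> norm y * norm (v - u)"
    using v by (simp add: norm_scale)
  have "norm (ip y u) \<le> norm y"
    using norm_ip_le[of y u] u by simp
  then have par: "norm (scale (ip y u) (v - u)) \<le> norm y * norm (v - u)"
    by (simp add: norm_scale mult_right_mono)
  have "U y - y = scale (ip y u) (v - u) - scale (ip (w y) v) v"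
    by (simp add: U_def w_def scale_right_diff_distrib)
  then show "norm (U y - y) \<le> 2 * norm (v - u) * norm y"
    using perp par norm_triangle_ineq4[of "scale (ip y u) (v - u)" "scale (ip (w y) v) v"]
    by (simp add: mult.commute[of "norm y"])
qed

section \<open>Maximizers of functionals\<close>

text \<open>This quantitative form of uniform convexity gives both existence and location of maximizers.\<close>

lemma unit_vectors_close:
  fixes x y :: 'h
  assumes "norm x = 1" "norm y = 1" "norm (x + y) \<ge> 2 - \<delta>"
  shows "(norm (x - y))\<^sup>2 \<le> 4 * \<delta>"
proof -
  have "(norm (x - y))\<^sup>2 = 4 - (norm (x + y))\<^sup>2"
    using parallelogram[of x y] assms by simp
  also have "\<dots> = (2 - norm (x + y)) * (2 + norm (x + y))"
    by (simp add: power2_eq_square algebra_simps)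
  also have "\<dots> \<le> (2 - norm (x + y)) * 4"
    using norm_triangle_ineq[of x y] assms(1,2) by (intro mult_left_mono) auto
  finally show ?thesis
    using assms(3) by simp
qed

text \<open>
  A maximizing sequence, rotated so that the functional is positive along it, is Cauchy because
  midpoints of its members are almost of norm one.
\<close>

lemma norm_attained:
  fixes f :: "'h \<Rightarrow> 'k"
  assumes lin: "Vector_Spaces.linear scale (*) f"
    and le: "\<And>y. norm (f y) \<le> norm y"
    and sup: "\<And>c. c < 1 \<Longrightarrow> \<exists>y. norm y = 1 \<and> c < norm (f y)"
  obtains v where "norm v = 1" "norm (f v) = 1"
proof -
  interpret f: Vector_Spaces.linear scale "(*)" f by (rule lin)
  have "\<exists>y. norm y = 1 \<and> f y = of_real (norm (f y)) \<and> 1 - 1 / Suc n < norm (f y)" for n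
  proof -
    obtain z where z: "norm z = 1" "1 - 1 / Suc n < norm (f z)"
      using sup[of "1 - 1 / Suc n"] by auto
    moreover have "0 \<le> 1 - 1 / real (Suc n)"
      by simp
    ultimately have nz: "f z \<noteq> 0"
      by auto
    let ?c = "of_real (norm (f z)) / f z"
    have "norm ?c = 1"
      using nz by (simp add: norm_divide)
    moreover have "f (scale ?c z) = of_real (norm (f z))"
      using nz by (simp add: f.scale)
    ultimately show ?thesis
      using z by (intro exI[of _ "scale ?c z"]) (simp add: norm_scale)
  qed
  then obtain y where y: "\<And>n. norm (y n) = 1" "\<And>n. f (y n) = of_real (norm (f (y n)))"
    "\<And>n. 1 - 1 / Suc n < norm (f (y n))"
    by metis
  have close: "(norm (y m - y n))\<^sup>2 \<le> 8 / Suc N" if "N \<le> m" "N \<le> n" for m n N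
  proof -
    have bd: "1 - 1 / Suc N \<le> norm (f (y k))" if "N \<le> k" for k
    proof -
      have "1 / real (Suc k) \<le> 1 / real (Suc N)"
        using that by (intro divide_left_mono) auto
      then show ?thesis using y(3)[of k] by linarith
    qed
    have "f (y m + y n) = of_real (norm (f (y m)) + norm (f (y n)))"
      by (metis f.add y(2) of_real_add)
    then have "norm (f (y m)) + norm (f (y n)) \<le> norm (y m + y n)"
      using le[of "y m + y n"] by (simp del: of_real_add)
    then have "2 - 2 / Suc N \<le> norm (y m + y n)"
      using bd[OF that(1)] bd[OF that(2)] by simp
    from unit_vectors_close[OF y(1) y(1) this] show ?thesis
      by simp
  qed
  have "Cauchy y"
  proof (rule metric_CauchyI)
    fix e :: real assume "0 < e"
    then obtain N where "8 / e\<^sup>2 < real N"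
      using reals_Archimedean2 by blast
    then have "8 / real (Suc N) < e\<^sup>2"
      using \<open>0 < e\<close> by (simp add: field_simps) (smt (verit) zero_less_power mult_less_cancel_left_pos)
    then have "dist (y m) (y n) < e" if "N \<le> m" "N \<le> n" for m n
      using close[OF that] \<open>0 < e\<close> by (intro power2_less_imp_less[of _ e]) (auto simp: dist_norm)
    then show "\<exists>N. \<forall>m\<ge>N. \<forall>n\<ge>N. dist (y m) (y n) < e"
      by blast
  qed
  then obtain v where v: "y \<longlonglongrightarrow> v"
    using Cauchy_convergent convergent_def by blast
  have "norm v = 1"
    using LIMSEQ_unique[OF tendsto_norm[OF v]] y(1) by simp
  moreover have "1 \<le> norm (f v)"
  proof (rule LIMSEQ_le_const2)
    have "1 - 1 / Suc n - norm (y n - v) \<le> norm (f v)" for n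
      using y(3)[of n] le[of "y n - v"] norm_triangle_ineq2[of "f (y n)" "f v"]
      by (simp add: f.diff)
    then show "\<exists>N. \<forall>n\<ge>N. 1 - 1 / Suc n - norm (y n - v) \<le> norm (f v)"
      by blast
    have "(\<lambda>n. 1 - 1 / real (Suc n) - norm (y n - v)) \<longlonglongrightarrow> 1 - 0 - norm (v - v)"
      using LIMSEQ_inverse_real_of_nat
      by (intro tendsto_intros v) (simp add: inverse_eq_divide)
    then show "(\<lambda>n. 1 - 1 / real (Suc n) - norm (y n - v)) \<longlonglongrightarrow> 1"
      by simp
  qed
  ultimately show thesis
    using le[of v] that[of v] by simp
qed

text \<open>
  The hypothesis \<open>f u \<noteq> 0\<close> gives \<open>f u\<close> a phase; a maximizer rotated to this phase is within
  \<open>2 * sqrt \<delta>\<close> of \<open>u\<close>.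
\<close>

lemma contraction_to_maximizer:
  fixes f :: "'h \<Rightarrow> 'k"
  assumes lin: "Vector_Spaces.linear scale (*) f"
    and le: "\<And>y. norm (f y) \<le> norm y"
    and sup: "\<And>c. c < 1 \<Longrightarrow> \<exists>y. norm y = 1 \<and> c < norm (f y)"
    and u: "norm u = 1" "1 - \<delta> \<le> norm (f u)" "f u \<noteq> 0"
  obtains U where "Vector_Spaces.linear scale scale U" "norm (f (U u)) = 1"
    "\<And>y. norm (U y) \<le> norm y" "\<And>y. norm (U y - y) \<le> 4 * sqrt \<delta> * norm y"
proof -
  interpret f: Vector_Spaces.linear scale "(*)" f by (rule lin)
  obtain v where v: "norm v = 1" "norm (f v) = 1"
    using norm_attained[OF lin le sup] by blast
  let ?s = "f u / of_real (norm (f u))"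
  \<comment> \<open>Rotating \<open>v\<close> gives its value under \<open>f\<close> the phase of \<open>f u\<close>, so that the two moduli add up.\<close>
  define v' where "v' = scale (?s / f v) v"
  have s: "norm ?s = 1"
    using u(3) by (simp add: norm_divide)
  have v': "norm v' = 1" "f v' = ?s"
  proof -
    have "norm (?s / f v) = 1"
      by (simp only: norm_divide[of ?s] s v(2) div_by_1)
    moreover have "f v \<noteq> 0"
      using v(2) by auto
    ultimately show "norm v' = 1" "f v' = ?s"
      using v(1) by (simp_all add: v'_def norm_scale f.scale del: norm_divide)
  qed
  have "f (v' + u) = (1 + of_real (norm (f u))) * ?s"
    using u(3) v'(2) by (simp add: f.add field_simps)
  then have "norm (f (v' + u)) = norm (1 + of_real (norm (f u)) :: 'k)"
    by (simp only: norm_mult s mult_1_right)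
  also have "\<dots> = 1 + norm (f u)"
    by (metis abs_of_nonneg add_nonneg_nonneg norm_ge_zero norm_of_real of_real_1 of_real_add
        zero_le_one)
  finally have "2 - \<delta> \<le> norm (v' + u)"
    using u(2) le[of "v' + u"] by simp
  from unit_vectors_close[OF v'(1) u(1) this]
  have "norm (v' - u) \<le> sqrt (4 * \<delta>)"
    by (rule real_le_rsqrt)
  then have close: "norm (v' - u) \<le> 2 * sqrt \<delta>"
    by (simp add: real_sqrt_mult)
  obtain U where U: "Vector_Spaces.linear scale scale U" "U u = v'"
    "\<And>y. norm (U y) \<le> norm y" "\<And>y. norm (U y - y) \<le> 2 * norm (v' - u) * norm y"
    using contraction_moving_unit_vector[OF u(1) v'(1)] by blast
  have "norm (U y - y) \<le> 4 * sqrt \<delta> * norm y" for y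
  proof -
    have "2 * norm (v' - u) * norm y \<le> 4 * sqrt \<delta> * norm y"
      using close by (intro mult_right_mono) auto
    then show ?thesis using U(4)[of y] by linarith
  qed
  then show thesis
    using that[of U] U v'(2) s by simp
qed

end

section \<open>Operators into the dual of a Hilbert space\<close>

text \<open>
  The type \<open>'t\<close> stands for the operators from \<open>'x\<close> into the dual of \<open>'h\<close>, and
  \<open>value_norm T x\<close> for the dual norm of the value of \<open>T\<close> at \<open>x\<close>. The dual itself is kept out
  of the signature because it is a different type constructor for real and for complex scalars; the
  norm axioms describe it by its effect on vectors of \<open>'h\<close>.
\<close>

locale dual_valued_operators = scalar_hilbert scale conj ip
  for scale :: "'k::real_normed_field \<Rightarrow> 'h::banach \<Rightarrow> 'h" and conj ip +
  fixes eval :: "'t::real_normed_vector \<Rightarrow> 'x::real_normed_vector \<Rightarrow> 'h \<Rightarrow> 'k"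
    and value_norm :: "'t \<Rightarrow> 'x \<Rightarrow> real"
  assumes eval_linear: "Vector_Spaces.linear scale (*) (eval T x)"
    and eval_diff: "eval (S - T) x y = eval S x y - eval T x y"
    and norm_le_iff: "0 \<le> c \<Longrightarrow> norm T \<le> c \<longleftrightarrow> (\<forall>x y. norm (eval T x y) \<le> c * norm x * norm y)"
    and value_norm_le_iff: "0 \<le> c \<Longrightarrow> value_norm T x \<le> c \<longleftrightarrow> (\<forall>y. norm (eval T x y) \<le> c * norm y)"
    and eval_compose: "Vector_Spaces.linear scale scale U \<Longrightarrow> (\<And>y. norm (U y) \<le> norm y) \<Longrightarrow>
      \<exists>S. \<forall>x y. eval S x y = eval T x (U y)"
begin

lemma norm_eval_le: "norm (eval T x y) \<le> norm T * norm x * norm y"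
  using norm_le_iff[of "norm T" T] by simp

lemma norm_eval_le_value_norm:
  "value_norm T x \<le> c \<Longrightarrow> 0 \<le> c \<Longrightarrow> norm (eval T x y) \<le> c * norm y"
  by (simp add: value_norm_le_iff)

lemma value_norm_le: "value_norm T x \<le> norm T * norm x"
  by (simp add: value_norm_le_iff norm_eval_le)

lemma exists_unit_above:
  assumes "0 \<le> c" "c < value_norm T x"
  obtains y where "norm y = 1" "c < norm (eval T x y)"
proof -
  interpret f: Vector_Spaces.linear scale "(*)" "eval T x" by (rule eval_linear)
  have "\<not> (\<forall>z. norm (eval T x z) \<le> c * norm z)"
    using assms value_norm_le_iff[of c T x] by simp
  then obtain z where z: "c * norm z < norm (eval T x z)"
    by (auto simp: not_le)
  then have nz: "z \<noteq> 0"
    by (auto simp: f.zero)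
  define y where "y = scale (of_real (inverse (norm z))) z"
  have "norm y = 1"
    using nz by (simp add: y_def norm_scale norm_inverse)
  moreover have "norm (eval T x y) = norm (eval T x z) / norm z"
    using nz by (simp add: y_def f.scale norm_mult norm_inverse divide_inverse)
  then have "c < norm (eval T x y)"
    using z nz by (simp add: pos_less_divide_eq)
  ultimately show thesis
    using that by blast
qed

text \<open>
  The left side is the point property of the bilinear forms \<open>eval T\<close>, the right side that of the
  operators \<open>T\<close>. The number \<open>\<epsilon>\<close> on the left
  is spent on two steps: from \<open>T\<close> to an operator attaining its norm at \<open>x\<close>, and from there to
  its composition with a contraction. The second distance is a multiple of the square root of the
  defect of the functional at \<open>y\<close>, because that is how far \<open>y\<close> can be from a maximizer.
\<close>

theorem point_property_forms_iff_operators: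
  "(\<forall>\<epsilon>>0. \<exists>\<eta>>0. \<forall>T x y. norm T = 1 \<and> norm x = 1 \<and> norm y = 1 \<and> norm (eval T x y) > 1 - \<eta> \<longrightarrow>
      (\<exists>S. norm S = 1 \<and> norm (eval S x y) = 1 \<and> norm (S - T) < \<epsilon>)) \<longleftrightarrow>
   (\<forall>\<epsilon>>0. \<exists>\<eta>>0. \<forall>T x. norm T = 1 \<and> norm x = 1 \<and> value_norm T x > 1 - \<eta> \<longrightarrow>
      (\<exists>S. norm S = 1 \<and> value_norm S x = 1 \<and> norm (S - T) < \<epsilon>))"
  (is "?forms \<longleftrightarrow> ?operators")
proof
  assume forms: ?forms
  show ?operators
  proof (intro allI impI)
    fix \<epsilon> :: real assume "0 < \<epsilon>"
    with forms obtain \<eta> where \<eta>: "0 < \<eta>" and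
      step: "\<And>T x y. norm T = 1 \<Longrightarrow> norm x = 1 \<Longrightarrow> norm y = 1 \<Longrightarrow> norm (eval T x y) > 1 - \<eta> \<Longrightarrow>
        \<exists>S. norm S = 1 \<and> norm (eval S x y) = 1 \<and> norm (S - T) < \<epsilon>"
      by metis
    \<comment> \<open>The minimum with \<open>1\<close> keeps the threshold nonnegative, as \<open>exists_unit_above\<close> requires.\<close>
    have "\<exists>S. norm S = 1 \<and> value_norm S x = 1 \<and> norm (S - T) < \<epsilon>"
      if T: "norm T = 1" "norm x = 1" "value_norm T x > 1 - min \<eta> 1" for T x
    proof -
      obtain y where y: "norm y = 1" "1 - min \<eta> 1 < norm (eval T x y)"
        using exists_unit_above[of "1 - min \<eta> 1" T x] T(3) by auto
      have "1 - \<eta> < norm (eval T x y)"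
        using y(2) by linarith
      then obtain S where S: "norm S = 1" "norm (eval S x y) = 1" "norm (S - T) < \<epsilon>"
        using step[OF T(1,2) y(1)] by blast
      have "value_norm S x \<le> 1"
        using value_norm_le[of S x] S T by simp
      moreover have "\<not> value_norm S x < 1"
      proof
        assume "value_norm S x < 1"
        then have "norm (eval S x y) \<le> max 0 (value_norm S x) * norm y"
          by (intro norm_eval_le_value_norm) auto
        with \<open>value_norm S x < 1\<close> show False
          using S y by (simp add: max_def split: if_splits)
      qed
      ultimately show ?thesis
        using S by (intro exI[of _ S]) auto
    qed
    then show "\<exists>\<eta>>0. \<forall>T x. norm T = 1 \<and> norm x = 1 \<and> value_norm T x > 1 - \<eta> \<longrightarrow>
        (\<exists>S. norm S = 1 \<and> value_norm S x = 1 \<and> norm (S - T) < \<epsilon>)"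
      using \<eta> by (intro exI[of _ "min \<eta> 1"]) auto
  qed
next
  assume operators: ?operators
  show ?forms
  proof (intro allI impI)
    fix \<epsilon> :: real assume \<epsilon>: "0 < \<epsilon>"
    \<comment> \<open>The form is moved by less than \<open>\<epsilon>'\<close> in passing to \<open>S\<close>, then by at most \<open>4 * sqrt (2 * \<epsilon>')\<close>.
      The bound \<open>1 / 4\<close> keeps the value of \<open>S\<close> at the given pair away from \<open>0\<close>.\<close>
    define \<epsilon>' where "\<epsilon>' = min (1 / 4) (min (\<epsilon> / 2) (\<epsilon>\<^sup>2 / 128))"
    have "\<epsilon>' \<le> \<epsilon>\<^sup>2 / 128"
      by (simp add: \<epsilon>'_def)
    then have \<epsilon>': "0 < \<epsilon>'" "\<epsilon>' \<le> 1 / 4" "\<epsilon>' \<le> \<epsilon> / 2" "2 * \<epsilon>' \<le> (\<epsilon> / 8)\<^sup>2"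
      using \<epsilon> by (simp_all add: \<epsilon>'_def power_divide)
    have sq: "4 * sqrt (2 * \<epsilon>') \<le> \<epsilon> / 2"
      using real_le_lsqrt[OF _ \<epsilon>'(4)] \<epsilon> by simp
    obtain \<eta> where \<eta>: "0 < \<eta>" and
      step: "\<And>T x. norm T = 1 \<Longrightarrow> norm x = 1 \<Longrightarrow> value_norm T x > 1 - \<eta> \<Longrightarrow>
        \<exists>S. norm S = 1 \<and> value_norm S x = 1 \<and> norm (S - T) < \<epsilon>'"
      using operators \<epsilon>'(1) by metis
    have "\<exists>A. norm A = 1 \<and> norm (eval A x y) = 1 \<and> norm (A - T) < \<epsilon>"
      if T: "norm T = 1" "norm x = 1" "norm y = 1" "norm (eval T x y) > 1 - min \<eta> \<epsilon>'" for T x y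
    proof -
      have "norm (eval T x y) \<le> max 0 (value_norm T x) * norm y"
        by (intro norm_eval_le_value_norm) auto
      then have "value_norm T x > 1 - \<eta>"
        using T(3,4) \<epsilon>' by (auto simp: max_def min_def split: if_splits)
      then obtain S where S: "norm S = 1" "value_norm S x = 1" "norm (S - T) < \<epsilon>'"
        using step[OF T(1,2)] by blast
      have "norm (eval (S - T) x y) \<le> norm (S - T)"
        using norm_eval_le[of "S - T" x y] T by simp
      then have near: "1 - 2 * \<epsilon>' < norm (eval S x y)"
        using T(4) S(3) norm_triangle_ineq3[of "eval S x y" "eval T x y"]
        by (simp add: eval_diff)
      have le: "norm (eval S x z) \<le> norm z" for z
        using norm_eval_le[of S x z] S T by simp
      have sup: "\<exists>z. norm z = 1 \<and> c < norm (eval S x z)" if "c < 1" for c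
        using exists_unit_above[of "max 0 c" S x] S(2) that by auto
      have nonzero: "eval S x y \<noteq> 0"
        using near \<epsilon>'(2) by auto
      obtain U where U: "Vector_Spaces.linear scale scale U"
        "norm (eval S x (U y)) = 1" "\<And>z. norm (U z) \<le> norm z"
        "\<And>z. norm (U z - z) \<le> 4 * sqrt (2 * \<epsilon>') * norm z"
        using contraction_to_maximizer[OF eval_linear le sup T(3) less_imp_le[OF near] nonzero]
        by blast
      obtain A where A: "\<And>x z. eval A x z = eval S x (U z)"
        using eval_compose[OF U(1,3)] by metis
      have "norm (eval A x' z) \<le> 1 * norm x' * norm z" for x' z
        using norm_eval_le[of S x' "U z"] S(1) mult_left_mono[OF U(3)[of z], of "norm x'"] A
        by simp
      then have "norm A \<le> 1"
        by (subst norm_le_iff) auto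
      moreover have "norm (eval A x y) = 1"
        using A U(2) by simp
      moreover have "1 \<le> norm A"
        using norm_eval_le[of A x y] T A U(2) by simp
      moreover have "norm (A - S) \<le> 4 * sqrt (2 * \<epsilon>')"
      proof -
        have "norm (eval (A - S) x' z) \<le> 4 * sqrt (2 * \<epsilon>') * norm x' * norm z" for x' z
        proof -
          interpret f: Vector_Spaces.linear scale "(*)" "eval S x'" by (rule eval_linear)
          have "norm (eval (A - S) x' z) = norm (eval S x' (U z - z))"
            by (simp add: eval_diff A f.diff)
          also have "\<dots> \<le> norm x' * norm (U z - z)"
            using norm_eval_le[of S x' "U z - z"] S(1) by simp
          also have "\<dots> \<le> norm x' * (4 * sqrt (2 * \<epsilon>') * norm z)"
            using U(4) by (intro mult_left_mono) auto
          finally show ?thesis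
            by (simp add: mult_ac)
        qed
        then show ?thesis
          using \<epsilon>'(1) by (subst norm_le_iff) auto
      qed
      moreover have "norm (A - T) \<le> norm (A - S) + norm (S - T)"
        using norm_triangle_ineq[of "A - S" "S - T"] by simp
      ultimately show ?thesis
        using S(3) sq \<epsilon>'(3) by (intro exI[of _ A]) auto
    qed
    then show "\<exists>\<eta>>0. \<forall>T x y. norm T = 1 \<and> norm x = 1 \<and> norm y = 1 \<and> norm (eval T x y) > 1 - \<eta> \<longrightarrow>
        (\<exists>S. norm S = 1 \<and> norm (eval S x y) = 1 \<and> norm (S - T) < \<epsilon>)"
      using \<eta> \<epsilon>' by (intro exI[of _ "min \<eta> \<epsilon>'"]) auto
  qed
qed

end

section \<open>Bilinear mappings as operators\<close>

text \<open>
  The next two lemmas turn quantification over bounded bilinear mappings into quantification over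
  the operators \<open>T\<close> that represent them, \<open>g T\<close> being the mapping represented by \<open>T\<close>.
\<close>

lemma ex_image_conj_iff: "(\<exists>A. (\<exists>S. A = g S) \<and> P A) \<longleftrightarrow> (\<exists>S. P (g S))"
  by blast

lemma all_image_conj_imp_iff:
  "(\<forall>B x y. (\<exists>T. B = g T) \<and> P B x y \<longrightarrow> Q B x y) \<longleftrightarrow> (\<forall>T x y. P (g T) x y \<longrightarrow> Q (g T) x y)"
  by blast

lemma bilinear_norm_le_iff:
  assumes "bounded_bilinear B" "0 \<le> c"
  shows "bilinear_norm B \<le> c \<longleftrightarrow> (\<forall>x y. norm (B x y) \<le> c * norm x * norm y)"
proof -
  interpret bounded_bilinear B by (rule assms(1))
  obtain K where K: "0 \<le> K" "\<And>x y. norm (B x y) \<le> norm x * norm y * K"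
    using nonneg_bounded by blast
  have "norm (B x y) \<le> K" if "norm x \<le> 1" "norm y \<le> 1" for x y
  proof -
    have "norm x * norm y * K \<le> 1 * 1 * K"
      using that K(1) by (intro mult_right_mono mult_mono) auto
    then show ?thesis using K(2)[of x y] by simp
  qed
  then have bdd: "bdd_above ((\<lambda>(x, y). norm (B x y)) ` (cball 0 1 \<times> cball 0 1))"
    by (intro bdd_aboveI2[of _ _ K]) auto
  have "bilinear_norm B \<le> c \<longleftrightarrow> (\<forall>x y. norm x \<le> 1 \<longrightarrow> norm y \<le> 1 \<longrightarrow> norm (B x y) \<le> c)"
    unfolding bilinear_norm_def by (subst cSUP_le_iff[OF _ bdd]) auto
  also have "\<dots> \<longleftrightarrow> (\<forall>x y. norm (B x y) \<le> c * norm x * norm y)"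
  proof safe
    fix x y
    assume ball: "\<forall>x y. norm x \<le> 1 \<longrightarrow> norm y \<le> 1 \<longrightarrow> norm (B x y) \<le> c"
    show "norm (B x y) \<le> c * norm x * norm y"
    proof (cases "x = 0 \<or> y = 0")
      case True
      then show ?thesis using zero_left zero_right by auto
    next
      case False
      have "norm (B (x /\<^sub>R norm x) (y /\<^sub>R norm y)) \<le> c"
        using ball False by simp
      then show ?thesis
        using False by (simp add: scaleR_left scaleR_right field_simps)
    qed
  next
    fix x y :: 'a and z :: 'b
    assume hom: "\<forall>x y. norm (B x y) \<le> c * norm x * norm y" and "norm x \<le> 1" "norm z \<le> 1"
    then have "c * norm x * norm z \<le> c * 1 * 1"
      using assms(2) by (intro mult_mono) auto
    then show "norm (B x z) \<le> c"
      using hom[rule_format, of x z] by simp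
  qed
  finally show ?thesis .
qed

lemma bilinear_norm_nonneg:
  assumes "bounded_bilinear B"
  shows "0 \<le> bilinear_norm B"
proof (rule ccontr)
  \<comment> \<open>A negative norm would be at most \<open>0\<close>, so \<open>B\<close> would vanish and have norm \<open>0\<close>.\<close>
  assume neg: "\<not> 0 \<le> bilinear_norm B"
  then have "\<forall>x y. norm (B x y) \<le> 0"
    using bilinear_norm_le_iff[OF assms, of 0] by simp
  then have "bilinear_norm B = 0"
    by (simp add: bilinear_norm_def case_prod_beta)
  with neg show False by simp
qed

text \<open>
  The supremum and an operator norm agree as soon as they have the same nonnegative upper bounds, so
  no supremum has to be computed below.
\<close>

lemma bilinear_norm_eqI:
  assumes "bounded_bilinear B" "0 \<le> n"
    and "\<And>c. 0 \<le> c \<Longrightarrow> n \<le> c \<longleftrightarrow> (\<forall>x y. norm (B x y) \<le> c * norm x * norm y)"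
  shows "bilinear_norm B = n"
  using assms bilinear_norm_le_iff[OF assms(1)] bilinear_norm_nonneg[OF assms(1)]
  by (intro antisym) auto

lemma norm_blinfun_le_iff:
  assumes "0 \<le> c"
  shows "norm (T :: 'a::real_normed_vector \<Rightarrow>\<^sub>L 'b::real_normed_vector) \<le> c \<longleftrightarrow>
    (\<forall>x. norm (blinfun_apply T x) \<le> c * norm x)"
  by (metis assms norm_blinfun norm_blinfun_bound mult_right_mono norm_ge_zero order_trans)

lemma norm_cblinfun_le_iff:
  assumes "0 \<le> c"
  shows "norm (T :: 'a::complex_normed_vector \<Rightarrow>\<^sub>C\<^sub>L 'b::complex_normed_vector) \<le> c \<longleftrightarrow>
    (\<forall>x. norm (cblinfun_apply T x) \<le> c * norm x)"
  using assms by (simp add: norm_cblinfun.rep_eq cblinfun_apply_def norm_blinfun_le_iff)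

subsection \<open>Real scalars\<close>

lemma bounded_bilinear_iff_blinfun:
  "bounded_bilinear B \<longleftrightarrow> (\<exists>T. B = (\<lambda>x y. blinfun_apply (blinfun_apply T x) y))"
proof
  assume B: "bounded_bilinear B"
  then have "B = (\<lambda>x y. blinfun_apply (blinfun_apply (Blinfun (bounded_bilinear.prod_right B)) x) y)"
    by (simp add: bounded_linear_Blinfun_apply bounded_bilinear.bounded_linear_prod_right
        bounded_bilinear.prod_right.rep_eq)
  then show "\<exists>T. B = (\<lambda>x y. blinfun_apply (blinfun_apply T x) y)"
    by blast
next
  assume "\<exists>T. B = (\<lambda>x y. blinfun_apply (blinfun_apply T x) y)"
  then show "bounded_bilinear B"
    using bounded_bilinear.comp1[OF bounded_bilinear_blinfun_apply blinfun.bounded_linear_right]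
    by blast
qed

lemma norm_bilinear_blinfun_le_iff:
  assumes "0 \<le> c"
  shows "norm T \<le> c \<longleftrightarrow> (\<forall>x y. norm (blinfun_apply (blinfun_apply T x) y) \<le> c * norm x * norm y)"
  using assms by (simp add: norm_blinfun_le_iff)

lemma bilinear_norm_blinfun:
  "bilinear_norm (\<lambda>x y. blinfun_apply (blinfun_apply T x) y) = norm T"
  using bounded_bilinear_iff_blinfun norm_bilinear_blinfun_le_iff by (intro bilinear_norm_eqI) auto

lemma BPBpp_bilinear_real_blinfun:
  "BPBpp_bilinear_real TYPE('x::banach) TYPE('y::banach) TYPE('z::banach) \<longleftrightarrow>
    (\<forall>\<epsilon>>0. \<exists>\<eta>>0. \<forall>(T :: 'x \<Rightarrow>\<^sub>L 'y \<Rightarrow>\<^sub>L 'z) x y.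
      norm T = 1 \<and> norm x = 1 \<and> norm y = 1 \<and> norm (blinfun_apply (blinfun_apply T x) y) > 1 - \<eta> \<longrightarrow>
      (\<exists>S :: 'x \<Rightarrow>\<^sub>L 'y \<Rightarrow>\<^sub>L 'z. norm S = 1 \<and> norm (blinfun_apply (blinfun_apply S x) y) = 1 \<and>
        norm (S - T) < \<epsilon>))"
proof -
  have diff: "bilinear_norm (\<lambda>x y. blinfun_apply (blinfun_apply S x) y - blinfun_apply (blinfun_apply T x) y)
    = norm (S - T)" for S T :: "'x \<Rightarrow>\<^sub>L 'y \<Rightarrow>\<^sub>L 'z"
    using bilinear_norm_blinfun[of "S - T"] by (simp add: blinfun.diff_left)
  show ?thesis
    unfolding BPBpp_bilinear_real_def bounded_bilinear_iff_blinfun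
      ex_image_conj_iff all_image_conj_imp_iff bilinear_norm_blinfun diff ..
qed

interpretation real_hilbert: scalar_hilbert
  "scaleR :: real \<Rightarrow> 'h \<Rightarrow> 'h::{real_inner, banach}" "\<lambda>a. a" inner
  by unfold_locales
    (simp_all add: algebra_simps inner_commute inner_add_left dot_square_norm power2_eq_square)

interpretation real_dual: dual_valued_operators
  "scaleR :: real \<Rightarrow> 'h \<Rightarrow> 'h::{real_inner, banach}" "\<lambda>a. a" inner
  "\<lambda>(T :: 'x::banach \<Rightarrow>\<^sub>L 'h \<Rightarrow>\<^sub>L real) x. blinfun_apply (blinfun_apply T x)"
  "\<lambda>T x. norm (blinfun_apply T x)"
proof (intro dual_valued_operators.intro dual_valued_operators_axioms.intro
    real_hilbert.scalar_hilbert_axioms)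
  fix S T :: "'x \<Rightarrow>\<^sub>L 'h \<Rightarrow>\<^sub>L real" and x y and c :: real and U :: "'h \<Rightarrow> 'h"
  show "Vector_Spaces.linear (*\<^sub>R) (*) (blinfun_apply (blinfun_apply T x))"
    by unfold_locales (simp_all add: blinfun.bilinear_simps algebra_simps)
  show "blinfun_apply (blinfun_apply (S - T) x) y
      = blinfun_apply (blinfun_apply S x) y - blinfun_apply (blinfun_apply T x) y"
    by (simp add: blinfun.bilinear_simps)
  assume "Vector_Spaces.linear (*\<^sub>R) (*\<^sub>R) U" and U: "\<And>y. norm (U y) \<le> norm y"
  then have "linear U"
    by (simp add: linear_def)
  then have "bounded_linear U"
    using U by (intro bounded_linear_intro[where K = 1]) (simp_all add: linear_add linear_scale)
  then have "bounded_bilinear (\<lambda>x y. blinfun_apply (blinfun_apply T x) (U y))"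
    by (intro bounded_bilinear.comp[OF bounded_bilinear_blinfun_apply blinfun.bounded_linear_right])
  then show "\<exists>S. \<forall>x y. blinfun_apply (blinfun_apply S x) y = blinfun_apply (blinfun_apply T x) (U y)"
    unfolding bounded_bilinear_iff_blinfun by metis
qed (simp_all add: norm_bilinear_blinfun_le_iff norm_blinfun_le_iff)

lemma BPBpp_bilinear_real_iff_BPBpp_real:
  "BPBpp_bilinear_real TYPE('x::banach) TYPE('h::{real_inner, banach}) TYPE(real) \<longleftrightarrow>
    BPBpp_real TYPE('x) TYPE('h \<Rightarrow>\<^sub>L real)"
  unfolding BPBpp_bilinear_real_blinfun BPBpp_real_def
  by (rule real_dual.point_property_forms_iff_operators)

subsection \<open>Complex scalars\<close>

lemma cblinfun_eqI: "(\<And>x. cblinfun_apply S x = cblinfun_apply T x) \<Longrightarrow> S = T"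
  unfolding cblinfun_apply_def by (metis blinfun_eqI blinfun_of_cblinfun_inject)

lemma bounded_linear_blinfun_of_cblinfun: "bounded_linear blinfun_of_cblinfun"
  by (rule bounded_linear_intro[where K = 1])
    (simp_all add: plus_cblinfun.rep_eq scaleR_cblinfun.rep_eq norm_cblinfun.rep_eq)

lemma bounded_bilinear_cblinfun_apply: "bounded_bilinear cblinfun_apply"
  unfolding cblinfun_apply_def
  using bounded_bilinear.comp1[OF bounded_bilinear_blinfun_apply bounded_linear_blinfun_of_cblinfun] .

interpretation cblinfun: bounded_bilinear cblinfun_apply
  by (rule bounded_bilinear_cblinfun_apply)

lemma cblinfun_apply_scaleC_right: "cblinfun_apply T (c *\<^sub>C x) = c *\<^sub>C cblinfun_apply T x"
  using blinfun_of_cblinfun[of T] by (simp add: cblinfun_apply_def)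

lemma cblinfun_apply_scaleC_left: "cblinfun_apply (c *\<^sub>C T) x = c *\<^sub>C cblinfun_apply T x"
  by (simp add: cblinfun_apply_def scaleC_cblinfun.rep_eq bounded_linear_Blinfun_apply
      bounded_linear_scaleC)

lemma cblinfun_of_bounded_linear:
  assumes "bounded_linear f" "\<And>c x. f (c *\<^sub>C x) = c *\<^sub>C f x"
  obtains T where "\<And>x. cblinfun_apply T x = f x"
proof
  show "cblinfun_apply (Abs_cblinfun (Blinfun f)) x = f x" for x
    using assms by (simp add: cblinfun_apply_def Abs_cblinfun_inverse bounded_linear_Blinfun_apply)
qed

lemma bounded_cbilinear_iff_cblinfun:
  "bounded_cbilinear B \<longleftrightarrow> (\<exists>T. B = (\<lambda>x y. cblinfun_apply (cblinfun_apply T x) y))"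
proof
  assume B: "bounded_cbilinear B"
  then interpret bounded_bilinear B by (simp add: bounded_cbilinear_def)
  have B_left: "B (c *\<^sub>C x) y = c *\<^sub>C B x y" and B_right: "B x (c *\<^sub>C y) = c *\<^sub>C B x y" for c x y
    using B by (simp_all add: bounded_cbilinear_def)
  have "\<exists>f. \<forall>y. cblinfun_apply f y = B x y" for x
    using cblinfun_of_bounded_linear[OF bounded_linear_right B_right] by metis
  then obtain F where F: "\<And>x y. cblinfun_apply (F x) y = B x y"
    by metis
  obtain K where K: "0 \<le> K" "\<And>x y. norm (B x y) \<le> norm x * norm y * K"
    using nonneg_bounded by blast
  have "bounded_linear F"
  proof (rule bounded_linear_intro)
    show "F (x + y) = F x + F y" for x y
      by (rule cblinfun_eqI) (simp add: F cblinfun.add_left add_left)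
    show "F (r *\<^sub>R x) = r *\<^sub>R F x" for r x
      by (rule cblinfun_eqI) (simp add: F cblinfun.scaleR_left scaleR_left)
    show "norm (F x) \<le> norm x * K" for x
      using K by (subst norm_cblinfun_le_iff) (simp_all add: F mult_ac)
  qed
  moreover have "F (c *\<^sub>C x) = c *\<^sub>C F x" for c x
    by (rule cblinfun_eqI) (simp add: F cblinfun_apply_scaleC_left B_left)
  ultimately obtain T where "\<And>x. cblinfun_apply T x = F x"
    using cblinfun_of_bounded_linear by metis
  then have "B = (\<lambda>x y. cblinfun_apply (cblinfun_apply T x) y)"
    by (simp add: F)
  then show "\<exists>T. B = (\<lambda>x y. cblinfun_apply (cblinfun_apply T x) y)"
    by blast
next
  assume "\<exists>T. B = (\<lambda>x y. cblinfun_apply (cblinfun_apply T x) y)"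
  then show "bounded_cbilinear B"
    using bounded_bilinear.comp1[OF bounded_bilinear_cblinfun_apply cblinfun.bounded_linear_right]
    by (auto simp: bounded_cbilinear_def cblinfun_apply_scaleC_left cblinfun_apply_scaleC_right)
qed

lemma norm_bilinear_cblinfun_le_iff:
  assumes "0 \<le> c"
  shows "norm T \<le> c \<longleftrightarrow> (\<forall>x y. norm (cblinfun_apply (cblinfun_apply T x) y) \<le> c * norm x * norm y)"
  using assms by (simp add: norm_cblinfun_le_iff)

lemma bilinear_norm_cblinfun:
  "bilinear_norm (\<lambda>x y. cblinfun_apply (cblinfun_apply T x) y) = norm T"
proof (rule bilinear_norm_eqI)
  show "bounded_bilinear (\<lambda>x y. cblinfun_apply (cblinfun_apply T x) y)"
    using bounded_cbilinear_iff_cblinfun bounded_cbilinear_def by blast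
qed (simp_all add: norm_bilinear_cblinfun_le_iff)

lemma BPBpp_bilinear_complex_cblinfun:
  "BPBpp_bilinear_complex TYPE('x::cbanach) TYPE('y::cbanach) TYPE('z::cbanach) \<longleftrightarrow>
    (\<forall>\<epsilon>>0. \<exists>\<eta>>0. \<forall>(T :: 'x \<Rightarrow>\<^sub>C\<^sub>L 'y \<Rightarrow>\<^sub>C\<^sub>L 'z) x y.
      norm T = 1 \<and> norm x = 1 \<and> norm y = 1 \<and> norm (cblinfun_apply (cblinfun_apply T x) y) > 1 - \<eta> \<longrightarrow>
      (\<exists>S :: 'x \<Rightarrow>\<^sub>C\<^sub>L 'y \<Rightarrow>\<^sub>C\<^sub>L 'z. norm S = 1 \<and> norm (cblinfun_apply (cblinfun_apply S x) y) = 1 \<and>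
        norm (S - T) < \<epsilon>))"
proof -
  have diff: "bilinear_norm (\<lambda>x y. cblinfun_apply (cblinfun_apply S x) y - cblinfun_apply (cblinfun_apply T x) y)
    = norm (S - T)" for S T :: "'x \<Rightarrow>\<^sub>C\<^sub>L 'y \<Rightarrow>\<^sub>C\<^sub>L 'z"
    using bilinear_norm_cblinfun[of "S - T"] by (simp add: cblinfun.diff_left)
  show ?thesis
    unfolding BPBpp_bilinear_complex_def bounded_cbilinear_iff_cblinfun
      ex_image_conj_iff all_image_conj_imp_iff bilinear_norm_cblinfun diff ..
qed

interpretation complex_hilbert: scalar_hilbert
  "scaleC :: complex \<Rightarrow> 'h \<Rightarrow> 'h::chilbert_space" cnj cinner
proof
  fix a b :: complex and x y z :: 'h
  show "1 *\<^sub>C x = x"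
    using scaleC_of_real[of 1 x] by simp
  show "a * cnj a = of_real ((cmod a)\<^sup>2)"
    by (simp add: complex_norm_square del: of_real_power)
qed (simp_all add: scaleC_add_left scaleC_add_right scaleC_scaleC norm_scaleC cinner_add_left
    cinner_scaleC_left cinner_self cinner_commute[symmetric] del: of_real_power)

interpretation complex_dual: dual_valued_operators
  "scaleC :: complex \<Rightarrow> 'h \<Rightarrow> 'h::chilbert_space" cnj cinner
  "\<lambda>(T :: 'x::cbanach \<Rightarrow>\<^sub>C\<^sub>L 'h \<Rightarrow>\<^sub>C\<^sub>L complex) x. cblinfun_apply (cblinfun_apply T x)"
  "\<lambda>T x. norm (cblinfun_apply T x)"
proof (intro dual_valued_operators.intro dual_valued_operators_axioms.intro
    complex_hilbert.scalar_hilbert_axioms)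
  fix S T :: "'x \<Rightarrow>\<^sub>C\<^sub>L 'h \<Rightarrow>\<^sub>C\<^sub>L complex" and x y and c :: real and U :: "'h \<Rightarrow> 'h"
  show "Vector_Spaces.linear (*\<^sub>C) (*) (cblinfun_apply (cblinfun_apply T x))"
    by unfold_locales
      (simp_all add: cblinfun.add_right cblinfun_apply_scaleC_right scaleC_complex_def algebra_simps)
  show "cblinfun_apply (cblinfun_apply (S - T) x) y
      = cblinfun_apply (cblinfun_apply S x) y - cblinfun_apply (cblinfun_apply T x) y"
    by (simp add: cblinfun.diff_left)
  assume lin: "Vector_Spaces.linear (*\<^sub>C) (*\<^sub>C) U" and U: "\<And>y. norm (U y) \<le> norm y"
  interpret U: Vector_Spaces.linear "(*\<^sub>C)" "(*\<^sub>C)" U by (rule lin)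
  have "U (r *\<^sub>R y) = r *\<^sub>R U y" for r y
    by (simp add: U.scale flip: scaleC_of_real)
  then have "bounded_linear U"
    using U by (intro bounded_linear_intro[where K = 1]) (simp_all add: U.add)
  then have "bounded_bilinear (\<lambda>x y. cblinfun_apply (cblinfun_apply T x) (U y))"
    by (intro bounded_bilinear.comp[OF bounded_bilinear_cblinfun_apply cblinfun.bounded_linear_right])
  then have "bounded_cbilinear (\<lambda>x y. cblinfun_apply (cblinfun_apply T x) (U y))"
    by (simp add: bounded_cbilinear_def cblinfun_apply_scaleC_left cblinfun_apply_scaleC_right U.scale)
  then show "\<exists>S. \<forall>x y. cblinfun_apply (cblinfun_apply S x) y = cblinfun_apply (cblinfun_apply T x) (U y)"
    unfolding bounded_cbilinear_iff_cblinfun by metis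
qed (simp_all add: norm_bilinear_cblinfun_le_iff norm_cblinfun_le_iff)

lemma BPBpp_bilinear_complex_iff_BPBpp_complex:
  "BPBpp_bilinear_complex TYPE('x::cbanach) TYPE('h::chilbert_space) TYPE(complex) \<longleftrightarrow>
    BPBpp_complex TYPE('x) TYPE('h \<Rightarrow>\<^sub>C\<^sub>L complex)"
  unfolding BPBpp_bilinear_complex_cblinfun BPBpp_complex_def
  by (rule complex_dual.point_property_forms_iff_operators)

section \<open>Equivalence of the point properties\<close>

theorem theorem3p1:
  shows "(uniformly_smooth TYPE('x::banach) \<longrightarrow>
           (BPBpp_bilinear_real TYPE('x) TYPE('h::{real_inner, banach}) TYPE(real) \<longleftrightarrow>
            BPBpp_real TYPE('x) TYPE('h \<Rightarrow>\<^sub>L real))) \<and>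
         (uniformly_smooth TYPE('cx::cbanach) \<longrightarrow>
           (BPBpp_bilinear_complex TYPE('cx) TYPE('ch::chilbert_space) TYPE(complex) \<longleftrightarrow>
            BPBpp_complex TYPE('cx) TYPE('ch \<Rightarrow>\<^sub>C\<^sub>L complex)))"
  using BPBpp_bilinear_real_iff_BPBpp_real BPBpp_bilinear_complex_iff_BPBpp_complex by blast

end
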